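(* Let $w \in \mathfrak{S}_n$ and $k \in [1,n-1]$. Then $$\max\nolimits_k(w) \le \min\big\{\mathsf{ValPair}_k(w),\mathsf{PosPair}_k(w)\big\} + 1.$$
   Context: $\mathfrak{S}_n$ is the symmetric group on $[1,n]$, written in one-line notation $w=w(1)\cdots w(n)$; $\sigma_i$ is the simple reflection exchanging $i$ and $i+1$. $\max_k(w)$ is the maximum, over all reduced decompositions (minimal-length expressions as products of simple reflections) of $w$, of the number of occurrences of the factor $\sigma_k$. An occurrence of $321$ is a triple of positions $i_1<i_2<i_3$ with $w(i_1)>w(i_2)>w(i_3)$; an occurrence of $3412$ is a quadruple of positions $i_1<i_2<i_3<i_4$ with $w(i_3)<w(i_4)<w(i_1)<w(i_2)$. Position and value pairs at $k$: (1) if $w$ has a $321$-occurrence in positions $i_1<i_2<i_3$ with $i_1\le k<i_3$, then $(i_1,i_3)$ is a position pair at $k$; (2) if $w$ has a $321$-occurrence with values $j_1<j_2<j_3$ with $j_1\le k<j_3$, then $(j_3,j_1)$ is a value pair at $k$; (3) if $w$ has a $3412$-occurrence in positions $i_1<i_2\le k<i_3<i_4$, then $(i_2,i_3)$ is a position pair at $k$; (4) if $w$ has a $3412$-occurrence with values $j_1<j_2\le k<j_3<j_4$, then $(j_4,j_1)$ is a value pair at $k$. $\mathsf{PosPair}_k(w)$ is the number of distinct position pairs at $k$ in $w$, and $\mathsf{ValPair}_k(w)$ is the number of distinct value pairs at $k$ in $w$ (a pair arising from several occurrences is counted once). *)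

theory Defs
  imports "HOL-Combinatorics.Combinatorics"
begin

text \<open>
  The symmetric group on \<open>[1,n]\<close> consists of the functions \<open>w\<close> with \<open>w permutes {1..n}\<close>;
  such a \<open>w\<close> fixes every natural number outside \<open>{1..n}\<close>.
\<close>

definition simple_refl :: "nat \<Rightarrow> nat \<Rightarrow> nat" where
  "simple_refl i = transpose i (Suc i)"

text \<open>
  The letter \<open>i\<close> of a word stands for the factor \<open>simple_refl i\<close>. Products are compositions of
  functions; the opposite convention reverses every word and so gives the same \<open>max_occ\<close>.
\<close>

definition word_prod :: "nat list \<Rightarrow> nat \<Rightarrow> nat" where
  "word_prod as = foldr (\<lambda>i f. simple_refl i \<circ> f) as id"

definition decomps :: "nat \<Rightarrow> (nat \<Rightarrow> nat) \<Rightarrow> nat list set" where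
  "decomps n w = {as. set as \<subseteq> {1..n - 1} \<and> word_prod as = w}"

definition reduced_decomps :: "nat \<Rightarrow> (nat \<Rightarrow> nat) \<Rightarrow> nat list set" where
  "reduced_decomps n w = {as \<in> decomps n w. \<forall>bs \<in> decomps n w. length as \<le> length bs}"

text \<open>
  For \<open>w permutes {1..n}\<close> the set below is finite (all reduced decompositions have the same length)
  and nonempty (the simple reflections generate the symmetric group), so \<open>Max\<close> is meaningful.
\<close>

definition max_occ :: "nat \<Rightarrow> nat \<Rightarrow> (nat \<Rightarrow> nat) \<Rightarrow> nat" where
  "max_occ n k w = Max ((\<lambda>as. count_list as k) ` reduced_decomps n w)"

definition occ321 :: "nat \<Rightarrow> (nat \<Rightarrow> nat) \<Rightarrow> nat \<Rightarrow> nat \<Rightarrow> nat \<Rightarrow> bool" where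
  "occ321 n w i1 i2 i3 \<longleftrightarrow>
     1 \<le> i1 \<and> i1 < i2 \<and> i2 < i3 \<and> i3 \<le> n \<and>
     w i1 > w i2 \<and> w i2 > w i3"

definition occ3412 :: "nat \<Rightarrow> (nat \<Rightarrow> nat) \<Rightarrow> nat \<Rightarrow> nat \<Rightarrow> nat \<Rightarrow> nat \<Rightarrow> bool" where
  "occ3412 n w i1 i2 i3 i4 \<longleftrightarrow>
     1 \<le> i1 \<and> i1 < i2 \<and> i2 < i3 \<and> i3 < i4 \<and> i4 \<le> n \<and>
     w i3 < w i4 \<and> w i4 < w i1 \<and> w i1 < w i2"

definition pos_pairs :: "nat \<Rightarrow> nat \<Rightarrow> (nat \<Rightarrow> nat) \<Rightarrow> (nat \<times> nat) set" where
  "pos_pairs n k w =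
     {(i1, i3) | i1 i2 i3. occ321 n w i1 i2 i3 \<and> i1 \<le> k \<and> k < i3} \<union>
     {(i2, i3) | i1 i2 i3 i4. occ3412 n w i1 i2 i3 i4 \<and> i2 \<le> k \<and> k < i3}"

text \<open>
  The values of a 321-occurrence in increasing order are \<open>j1 = w i3 < j2 = w i2 < j3 = w i1\<close>;
  those of a 3412-occurrence are \<open>j1 = w i3 < j2 = w i4 < j3 = w i1 < j4 = w i2\<close>.
\<close>

definition val_pairs :: "nat \<Rightarrow> nat \<Rightarrow> (nat \<Rightarrow> nat) \<Rightarrow> (nat \<times> nat) set" where
  "val_pairs n k w =
     {(w i1, w i3) | i1 i2 i3. occ321 n w i1 i2 i3 \<and> w i3 \<le> k \<and> k < w i1} \<union>
     {(w i2, w i3) | i1 i2 i3 i4. occ3412 n w i1 i2 i3 i4 \<and> w i4 \<le> k \<and> k < w i1}"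

definition PosPair :: "nat \<Rightarrow> nat \<Rightarrow> (nat \<Rightarrow> nat) \<Rightarrow> nat" where
  "PosPair n k w = card (pos_pairs n k w)"

definition ValPair :: "nat \<Rightarrow> nat \<Rightarrow> (nat \<Rightarrow> nat) \<Rightarrow> nat" where
  "ValPair n k w = card (val_pairs n k w)"

end

theory Submission
  imports Defs
begin

text \<open>
  Build \<open>w\<close> from the identity by a reduced word, each letter \<open>i\<close> exchanging the entries in the
  ascending positions \<open>i\<close> and \<open>i + 1\<close>. A letter \<open>i \<noteq> k\<close> carries position pairs at \<open>k\<close> injectively
  to position pairs at \<open>k\<close>, and the letter \<open>k\<close> keeps all of them and, except at its first
  occurrence, adds a new one. This bounds the number of letters \<open>k\<close> by the number of position
  pairs plus one. Reversing the words gives the same bound with the position pairs of the inverse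
  of \<open>w\<close>. Value pairs of \<open>w\<close> correspond to pairs of positions of its inverse in which a
  3412-occurrence contributes its outer instead of its inner positions, so it remains to inject
  the inner pairs into the outer ones.
\<close>

section \<open>Reduced words\<close>

lemma word_prod_Nil [simp]: "word_prod [] = id"
  by (simp add: word_prod_def)

lemma word_prod_Cons [simp]: "word_prod (i # as) = simple_refl i \<circ> word_prod as"
  by (simp add: word_prod_def)

lemma word_prod_append: "word_prod (as @ bs) = word_prod as \<circ> word_prod bs"
  by (induction as) (auto simp: comp_assoc)

lemma simple_refl_involutory [simp]: "simple_refl i (simple_refl i x) = x"
  by (simp add: simple_refl_def)

lemma bij_simple_refl: "bij (simple_refl i)"
  by (simp add: simple_refl_def)

lemma bij_word_prod: "bij (word_prod as)"
  by (induction as) (simp_all only: word_prod_Nil word_prod_Cons bij_id bij_comp bij_simple_refl)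

lemma inv_word_prod: "inv (word_prod as) = word_prod (rev as)"
proof (induction as)
  case (Cons i as)
  have "inv (simple_refl i) = simple_refl i"
    by (simp add: simple_refl_def)
  with Cons o_inv_distrib[OF bij_simple_refl bij_word_prod, of i as] show ?case
    by (simp only: word_prod_Cons word_prod_append rev.simps word_prod_Nil comp_id)
qed (simp only: word_prod_Nil rev.simps inv_id)

text \<open>This is the exchange condition, by peeling off the leading letter \<open>c\<close>.
  Either the tail already has the descent at \<open>i\<close>, or \<open>c\<close> creates it. In
  that case the tail sends \<open>i\<close>, \<open>i + 1\<close> to \<open>c\<close>,
  \<open>c + 1\<close>, so multiplying by both reflections returns the tail itself, and deleting
  \<open>c\<close> suffices.\<close>

lemma descent_exchange:
  assumes "word_prod as i > word_prod as (Suc i)"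
  shows "\<exists>bs. length bs < length as \<and> set bs \<subseteq> set as \<and>
           word_prod bs = word_prod as \<circ> simple_refl i"
  using assms
proof (induction as)
  case (Cons c as)
  let ?w = "word_prod as"
  show ?case
  proof (cases "?w i > ?w (Suc i)")
    case True
    with Cons.IH obtain bs where "length bs < length as" "set bs \<subseteq> set as"
      "word_prod bs = ?w \<circ> simple_refl i" by blast
    then show ?thesis
      by (intro exI[of _ "c # bs"]) (auto simp: comp_assoc)
  next
    case False
    have ne: "?w i \<noteq> ?w (Suc i)"
      using bij_word_prod[of as] by (metis bij_pointE n_not_Suc_n)
    with False Cons.prems have w: "?w i = c" "?w (Suc i) = Suc c"
      by (auto simp: simple_refl_def transpose_def split: if_splits)
    have "?w x = (word_prod (c # as) \<circ> simple_refl i) x" for x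
    proof -
      consider "x = i" | "x = Suc i" | "x \<noteq> i" "x \<noteq> Suc i" by blast
      then show ?thesis
      proof cases
        case 3
        then have "?w x \<noteq> c" "?w x \<noteq> Suc c"
          using w bij_word_prod[of as] by (metis bij_pointE)+
        with 3 show ?thesis by (simp add: simple_refl_def)
      qed (use w in \<open>simp_all add: simple_refl_def\<close>)
    qed
    then have "?w = word_prod (c # as) \<circ> simple_refl i" by (rule ext)
    moreover have "length as < length (c # as) \<and> set as \<subseteq> set (c # as)" by auto
    ultimately show ?thesis by blast
  qed
qed simp

text \<open>At a descent, the prefix \<open>xs @ [i]\<close> could be replaced by a word shorter
  than \<open>xs\<close>, against minimality.\<close>

lemma reduced_ascent:
  assumes "xs @ i # ys \<in> reduced_decomps n w"
  shows "word_prod xs i < word_prod xs (Suc i)"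
proof (rule ccontr)
  assume "\<not> word_prod xs i < word_prod xs (Suc i)"
  moreover have "word_prod xs i \<noteq> word_prod xs (Suc i)"
    using bij_word_prod[of xs] by (metis bij_pointE n_not_Suc_n)
  ultimately obtain bs where bs: "length bs < length xs" "set bs \<subseteq> set xs"
    "word_prod bs = word_prod xs \<circ> simple_refl i"
    using descent_exchange[of xs i] by force
  from assms bs have "bs @ ys \<in> decomps n w"
    by (auto simp: reduced_decomps_def decomps_def word_prod_append comp_assoc)
  with assms bs(1) show False
    by (fastforce simp: reduced_decomps_def)
qed

lemma rev_decomps:
  assumes "as \<in> decomps n w"
  shows "rev as \<in> decomps n (inv w)"
  using assms by (auto simp: decomps_def inv_word_prod)

lemma rev_reduced_decomps:
  assumes "w permutes {1..n}" "as \<in> reduced_decomps n w"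
  shows "rev as \<in> reduced_decomps n (inv w)"
proof -
  have "inv (inv w) = w"
    using assms(1) by (metis permutes_inv_inv)
  then have "length as \<le> length bs" if "bs \<in> decomps n (inv w)" for bs
    using rev_decomps[OF that] assms(2) by (force simp: reduced_decomps_def)
  with assms(2) show ?thesis
    by (auto simp: reduced_decomps_def intro: rev_decomps)
qed

section \<open>Existence and finiteness of reduced decompositions\<close>

lemma transpose_decomp:
  assumes "1 \<le> a" "a < b" "b \<le> n"
  shows "\<exists>as. set as \<subseteq> {1..n - 1} \<and> word_prod as = transpose a b"
proof -
  have "Suc a \<le> b" using assms(2) by simp
  then have "b \<le> n \<longrightarrow> (\<exists>as. set as \<subseteq> {1..n - 1} \<and> word_prod as = transpose a b)"
  proof (induction b rule: dec_induct)
    case base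
    show ?case
      using assms(1) by (intro impI exI[of _ "[a]"]) (auto simp: simple_refl_def)
  next
    case (step b)
    show ?case
    proof
      assume b: "Suc b \<le> n"
      with step.IH obtain as where as: "set as \<subseteq> {1..n - 1}" "word_prod as = transpose a b"
        by auto
      \<comment> \<open>Conjugation by \<open>simple_refl b\<close> moves the upper end from
        \<open>b\<close> to \<open>b + 1\<close>.\<close>
      have "word_prod (b # as @ [b]) = transpose a (Suc b)"
        using step.hyps as(2)
        by (auto simp: word_prod_append simple_refl_def transpose_def fun_eq_iff)
      with as(1) b step.hyps assms(1) show
        "\<exists>as. set as \<subseteq> {1..n - 1} \<and> word_prod as = transpose a (Suc b)"
        by (intro exI[of _ "b # as @ [b]"]) auto
    qed
  qed
  with assms(3) show ?thesis by blast
qed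

lemma decomps_nonempty:
  assumes "w permutes {1..n}"
  shows "decomps n w \<noteq> {}"
  using assms finite_atLeastAtMost[of 1 n]
proof (induction rule: permutes_induct)
  case id
  have "[] \<in> decomps n id" by (simp add: decomps_def)
  then show ?case by blast
next
  case (swap a b p)
  have "\<exists>as. set as \<subseteq> {1..n - 1} \<and> word_prod as = transpose a b"
    using swap transpose_decomp[of a b n] transpose_decomp[of b a n]
    by (cases "a < b") (auto simp: transpose_commute)
  then obtain as where "set as \<subseteq> {1..n - 1}" "word_prod as = transpose a b"
    by blast
  moreover obtain bs where "bs \<in> decomps n p"
    using swap.IH by blast
  ultimately have "as @ bs \<in> decomps n (transpose a b \<circ> p)"
    by (simp add: decomps_def word_prod_append)
  then show ?case by blast
qed

lemma reduced_decomps_nonempty: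
  assumes "w permutes {1..n}"
  shows "reduced_decomps n w \<noteq> {}"
proof -
  obtain as where "as \<in> decomps n w" "\<forall>bs. bs \<in> decomps n w \<longrightarrow> length as \<le> length bs"
    using decomps_nonempty[OF assms] ex_has_least_nat[of "\<lambda>as. as \<in> decomps n w" _ length]
    by blast
  then show ?thesis by (auto simp: reduced_decomps_def)
qed

lemma finite_reduced_decomps: "finite (reduced_decomps n w)"
proof (cases "reduced_decomps n w = {}")
  case False
  then obtain as where as: "as \<in> reduced_decomps n w" by blast
  have "length bs = length as" if "bs \<in> reduced_decomps n w" for bs
    using as that by (intro le_antisym) (auto simp: reduced_decomps_def)
  then have "reduced_decomps n w \<subseteq> {bs. set bs \<subseteq> {1..n - 1} \<and> length bs = length as}"
    by (auto simp: reduced_decomps_def decomps_def)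
  then show ?thesis
    by (rule finite_subset) (rule finite_lists_length_eq, simp)
qed simp

section \<open>Position pairs along a reduced word\<close>

lemma finite_pos_pairs: "finite (pos_pairs n k u)"
  by (rule finite_subset[of _ "{1..n} \<times> {1..n}"])
     (auto simp: pos_pairs_def occ321_def occ3412_def)

text \<open>
  In the second alternative the order of \<open>p'\<close>, \<open>p\<close> and that of \<open>q\<close>, \<open>q'\<close> is left open: if it is
  not the order of a 3412-occurrence, then \<open>p'\<close> or \<open>q'\<close> is the middle of a 321-occurrence.
\<close>

lemma pos_pairs_iff:
  "(p, q) \<in> pos_pairs n k u \<longleftrightarrow>
     (1 \<le> p \<and> p \<le> k \<and> k < q \<and> q \<le> n) \<and>
     ((\<exists>z. p < z \<and> z < q \<and> u q < u z \<and> u z < u p) \<or>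
      (\<exists>p' q'. 1 \<le> p' \<and> p' \<le> k \<and> k < q' \<and> q' \<le> n \<and>
         u q < u q' \<and> u q' < u p' \<and> u p' < u p))"
  (is "?L \<longleftrightarrow> ?B \<and> (?R1 \<or> ?R2)")
proof
  assume ?L
  then consider z where "occ321 n u p z q" "p \<le> k" "k < q"
    | p' q' where "occ3412 n u p' p q q'" "p \<le> k" "k < q"
    unfolding pos_pairs_def by blast
  then show "?B \<and> (?R1 \<or> ?R2)"
  proof cases
    case 1
    then show ?thesis by (auto simp: occ321_def)
  next
    case 2
    then have ?R2
      by (intro exI[of _ p'] exI[of _ q']) (auto simp: occ3412_def)
    with 2 show ?thesis by (auto simp: occ3412_def)
  qed
next
  assume R: "?B \<and> (?R1 \<or> ?R2)"
  have T: ?L if "p < z" "z < q" "u q < u z" "u z < u p" for z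
    using R that by (auto simp: pos_pairs_def occ321_def)
  from R consider ?R1 | ?R2 by blast
  then show ?L
  proof cases
    case 1
    then show ?thesis using T by blast
  next
    case 2
    then obtain p' q' where pq: "1 \<le> p'" "p' \<le> k" "k < q'" "q' \<le> n"
      "u q < u q'" "u q' < u p'" "u p' < u p" by blast
    then have ne: "p' \<noteq> p" "q' \<noteq> q" by auto
    consider "p < p'" | "q' < q" | "p' < p" "q < q'"
      using ne by linarith
    then show ?thesis
    proof cases
      case 1
      then show ?thesis using T[of p'] R pq by auto
    next
      case 2
      then show ?thesis using T[of q'] R pq by auto
    next
      case 3
      then have "occ3412 n u p' p q q'" using R pq by (auto simp: occ3412_def)
      then show ?thesis using R unfolding pos_pairs_def by blast
    qed
  qed
qed

text \<open>Since \<open>i \<noteq> k\<close>, the reflection preserves both sides of the cut at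
  \<open>k\<close>. Since \<open>u\<close> ascends at \<open>i\<close>, the positions
  \<open>i\<close>, \<open>i + 1\<close> do not form an inversion, so every inversion keeps its
  left-to-right order.\<close>

lemma pos_pairs_simple_refl:
  assumes "i \<in> {1..n - 1}" "i \<noteq> k" "u i < u (Suc i)" "(p, q) \<in> pos_pairs n k u"
  shows "(simple_refl i p, simple_refl i q) \<in> pos_pairs n k (u \<circ> simple_refl i)"
proof -
  let ?s = "simple_refl i"
  have left: "1 \<le> ?s a \<and> ?s a \<le> k" if "1 \<le> a" "a \<le> k" for a
    using that assms(1,2) by (auto simp: simple_refl_def transpose_def)
  have right: "k < ?s a \<and> ?s a \<le> n" if "k < a" "a \<le> n" for a
    using that assms(1,2) by (auto simp: simple_refl_def transpose_def)
  have mono: "?s a < ?s b" if "a < b" "u a > u b" for a b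
    using that assms(3) by (auto simp: simple_refl_def transpose_def)
  have bounds: "1 \<le> p" "p \<le> k" "k < q" "q \<le> n"
    using assms(4) by (auto simp: pos_pairs_iff)
  from assms(4) consider
      z where "p < z" "z < q" "u q < u z" "u z < u p"
    | p' q' where "1 \<le> p'" "p' \<le> k" "k < q'" "q' \<le> n" "u q < u q'" "u q' < u p'" "u p' < u p"
    unfolding pos_pairs_iff by blast
  then show ?thesis
  proof cases
    case 1
    then have "?s p < ?s z" "?s z < ?s q" by (auto intro: mono)
    with 1 left[of p] right[of q] bounds show ?thesis
      unfolding pos_pairs_iff by (auto intro!: exI[of _ "?s z"])
  next
    case 2
    with left[of p'] right[of q'] left[of p] right[of q] bounds show ?thesis
      unfolding pos_pairs_iff by (intro conjI disjI2 exI[of _ "?s p'"] exI[of _ "?s q'"]) auto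
  qed
qed

lemma PosPair_mono:
  assumes "i \<in> {1..n - 1}" "i \<noteq> k" "u i < u (Suc i)"
  shows "PosPair n k u \<le> PosPair n k (u \<circ> simple_refl i)"
  unfolding PosPair_def
proof (rule card_inj_on_le)
  show "inj_on (map_prod (simple_refl i) (simple_refl i)) (pos_pairs n k u)"
    by (rule inj_on_subset[OF map_prod_inj_on[OF bij_is_inj bij_is_inj]])
       (simp_all add: bij_simple_refl)
  show "map_prod (simple_refl i) (simple_refl i) ` pos_pairs n k u
          \<subseteq> pos_pairs n k (u \<circ> simple_refl i)"
    using pos_pairs_simple_refl[of i n k u] assms by auto
qed (rule finite_pos_pairs)

text \<open>A pair with one end at \<open>k\<close> or \<open>k + 1\<close> gets the other of these
  two positions as the middle of a 321. Any other pair keeps its end values, and its witnesses are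
  followed by value.\<close>

lemma pos_pairs_subset:
  assumes "k \<in> {1..n - 1}" "u k < u (Suc k)"
  shows "pos_pairs n k u \<subseteq> pos_pairs n k (u \<circ> simple_refl k)"
proof clarify
  fix p q assume pq: "(p, q) \<in> pos_pairs n k u"
  let ?v = "u \<circ> simple_refl k"
  have v: "?v k = u (Suc k)" "?v (Suc k) = u k" "\<And>x. x \<noteq> k \<Longrightarrow> x \<noteq> Suc k \<Longrightarrow> ?v x = u x"
    by (auto simp: simple_refl_def)
  have bounds: "1 \<le> p" "p \<le> k" "k < q" "q \<le> n" and inv: "u q < u p"
    using pq by (auto simp: pos_pairs_iff)
  then have *: "\<not> (p = k \<and> q = Suc k)" using assms(2) by auto
  show "(p, q) \<in> pos_pairs n k ?v"
  proof (cases "p = k \<or> q = Suc k")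
    case True
    then consider "p = k" "q \<noteq> Suc k" | "q = Suc k" "p \<noteq> k" using * by blast
    then show ?thesis
    proof cases
      case 1
      then show ?thesis
        unfolding pos_pairs_iff using bounds inv assms v
        by (auto intro!: exI[of _ "Suc k"])
    next
      case 2
      then show ?thesis
        unfolding pos_pairs_iff using bounds inv assms v
        by (auto intro!: exI[of _ k])
    qed
  next
    case False
    have old: "?v p = u p" "?v q = u q" using False bounds v(3) by auto
    from pq consider
        z where "p < z" "z < q" "u q < u z" "u z < u p"
      | p' q' where "1 \<le> p'" "p' \<le> k" "k < q'" "q' \<le> n" "u q < u q'" "u q' < u p'" "u p' < u p"
      unfolding pos_pairs_iff by blast
    then show ?thesis
    proof cases
      case 1
      have "p < simple_refl k z" "simple_refl k z < q"
        using 1 False bounds by (auto simp: simple_refl_def transpose_def)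
      with 1 show ?thesis
        unfolding pos_pairs_iff using bounds old
        by (auto intro!: exI[of _ "simple_refl k z"])
    next
      case 2
      \<comment> \<open>A witness at \<open>k\<close> or \<open>k + 1\<close> crosses the cut, but
        its value still lies strictly between those at \<open>q\<close> and \<open>p\<close>, so at
        its new place it is the middle of a 321.\<close>
      consider "p' = k" | "q' = Suc k" | "p' \<noteq> k" "q' \<noteq> Suc k" by blast
      then show ?thesis
      proof cases
        case 1
        then show ?thesis
          unfolding pos_pairs_iff using bounds False 2 old v
          by (auto intro!: exI[of _ "Suc k"])
      next
        assume "q' = Suc k"
        then show ?thesis
          unfolding pos_pairs_iff using bounds False 2 old v
          by (auto intro!: exI[of _ k])
      next
        assume "p' \<noteq> k" "q' \<noteq> Suc k"
        then have "?v p' = u p'" "?v q' = u q'" using 2 v(3) by auto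
        with 2 show ?thesis
          unfolding pos_pairs_iff using bounds old by metis
      qed
    qed
  qed
qed

text \<open>If some entry right of the cut is below \<open>u k\<close>, the largest such entry forms
  a new pair with position \<open>k\<close>; dually, the smallest entry on the left above
  \<open>u (Suc k)\<close> forms one with \<open>k + 1\<close>. If neither exists,
  \<open>u k < u b < u a < u (Suc k)\<close> holds and \<open>(k, Suc k)\<close> itself is
  new.\<close>

lemma pos_pairs_psubset:
  assumes "inj u" "k \<in> {1..n - 1}" "u k < u (Suc k)"
    and "1 \<le> a" "a \<le> k" "k < b" "b \<le> n" "u a > u b"
  shows "pos_pairs n k u \<noteq> pos_pairs n k (u \<circ> simple_refl k)"
proof -
  let ?v = "u \<circ> simple_refl k"
  have v: "?v k = u (Suc k)" "?v (Suc k) = u k" "\<And>x. x \<noteq> k \<Longrightarrow> x \<noteq> Suc k \<Longrightarrow> ?v x = u x"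
    by (auto simp: simple_refl_def)
  consider (right) b where "k < b" "b \<le> n" "u b < u k"
    | (left) a where "1 \<le> a" "a \<le> k" "u a > u (Suc k)"
    | (none) "\<And>c. k < c \<Longrightarrow> c \<le> n \<Longrightarrow> u c \<ge> u k" "\<And>c. 1 \<le> c \<Longrightarrow> c \<le> k \<Longrightarrow> u c \<le> u (Suc k)"
    by (meson not_le)
  then show ?thesis
  proof cases
    case right
    define B where "B = {u c | c. k < c \<and> c \<le> n \<and> u c < u k}"
    have B: "finite B" "B \<noteq> {}" using right by (auto simp: B_def)
    then obtain c where c: "k < c" "c \<le> n" "u c < u k" and "Max B = u c"
      using Max_in[OF B] by (auto simp: B_def)
    then have max: "u d \<le> u c" if "k < d" "d \<le> n" "u d < u k" for d
      using Max_ge[OF B(1), of "u d"] that by (auto simp: B_def)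
    have "c \<noteq> Suc k" using c assms(3) by auto
    then have "(k, c) \<in> pos_pairs n k ?v"
      unfolding pos_pairs_iff using c assms(2,3) v by (auto intro!: exI[of _ "Suc k"])
    \<comment> \<open>An old pair would need a further entry right of the cut with value strictly
      between \<open>u c\<close> and \<open>u k\<close>, against the choice of
      \<open>c\<close>.\<close>
    moreover have "(k, c) \<notin> pos_pairs n k u"
    proof
      assume "(k, c) \<in> pos_pairs n k u"
      then consider z where "k < z" "z < c" "u c < u z" "u z < u k"
        | p' q' where "k < q'" "q' \<le> n" "u c < u q'" "u q' < u p'" "u p' < u k"
        unfolding pos_pairs_iff by blast
      then show False
      proof cases
        case 1
        then show False using max[of z] c by simp
      next
        case 2
        then show False using max[of q'] by simp
      qed
    qed
    ultimately show ?thesis by blast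
  next
    case left
    define A where "A = {u c | c. 1 \<le> c \<and> c \<le> k \<and> u c > u (Suc k)}"
    have A: "finite A" "A \<noteq> {}" using left by (auto simp: A_def)
    then obtain c where c: "1 \<le> c" "c \<le> k" "u c > u (Suc k)" and "Min A = u c"
      using Min_in[OF A] by (auto simp: A_def)
    then have min: "u d \<ge> u c" if "1 \<le> d" "d \<le> k" "u d > u (Suc k)" for d
      using Min_le[OF A(1), of "u d"] that by (auto simp: A_def)
    have "c \<noteq> k" using c assms(3) by auto
    then have "(c, Suc k) \<in> pos_pairs n k ?v"
      unfolding pos_pairs_iff using c assms(2,3) v by (auto intro!: exI[of _ k])
    moreover have "(c, Suc k) \<notin> pos_pairs n k u"
    proof
      assume "(c, Suc k) \<in> pos_pairs n k u"
      then consider z where "c < z" "z < Suc k" "u (Suc k) < u z" "u z < u c"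
        | p' q' where "1 \<le> p'" "p' \<le> k" "u (Suc k) < u q'" "u q' < u p'" "u p' < u c"
        unfolding pos_pairs_iff by blast
      then show False
      proof cases
        case 1
        then show False using min[of z] c by simp
      next
        case 2
        then show False using min[of p'] by simp
      qed
    qed
    ultimately show ?thesis by blast
  next
    case none
    have "u k \<noteq> u b" "u a \<noteq> u (Suc k)"
      using assms by (auto dest!: injD[OF assms(1)])
    with none assms(4-) have "u k < u b" "u a < u (Suc k)"
      by (auto simp: order_less_le)
    moreover from this assms have "a \<noteq> k" "b \<noteq> Suc k" by auto
    ultimately have "(k, Suc k) \<in> pos_pairs n k ?v"
      unfolding pos_pairs_iff using assms v
      by (intro conjI disjI2 exI[of _ a] exI[of _ b]) auto
    moreover have "(k, Suc k) \<notin> pos_pairs n k u"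
      using assms(3) by (auto simp: pos_pairs_iff)
    ultimately show ?thesis by blast
  qed
qed

text \<open>
  The first crossing at \<open>k\<close> creates an inversion across \<open>k\<close>, which then persists; every later
  crossing at \<open>k\<close> creates a new position pair.
\<close>

lemma count_list_le_PosPair:
  assumes "k \<in> {1..n - 1}"
    and "as \<in> reduced_decomps n w"
  shows "count_list as k \<le> PosPair n k w + 1"
proof -
  have "count_list xs k \<le> PosPair n k (word_prod xs) + 1 \<and>
      (count_list xs k > 0 \<longrightarrow>
        (\<exists>a b. 1 \<le> a \<and> a \<le> k \<and> k < b \<and> b \<le> n \<and> word_prod xs a > word_prod xs b))"
    if "as = xs @ ys" for xs ys
    using that
  proof (induction xs arbitrary: ys rule: rev_induct)
    case (snoc i xs)
    let ?u = "word_prod xs"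
    have eq: "word_prod (xs @ [i]) = ?u \<circ> simple_refl i"
      by (simp add: word_prod_append)
    have i: "i \<in> {1..n - 1}"
      using assms(2) snoc.prems by (auto simp: reduced_decomps_def decomps_def)
    have asc: "?u i < ?u (Suc i)"
      using assms(2) snoc.prems by (auto intro: reduced_ascent)
    from snoc.prems have "as = xs @ i # ys" by simp
    note IH = snoc.IH[OF this]
    show ?case
    proof (cases "i = k")
      case False
      have "\<exists>a b. 1 \<le> a \<and> a \<le> k \<and> k < b \<and> b \<le> n \<and> (?u \<circ> simple_refl i) a > (?u \<circ> simple_refl i) b"
        if "count_list xs k > 0"
      proof -
        from that IH obtain a b where "1 \<le> a" "a \<le> k" "k < b" "b \<le> n" "?u a > ?u b" by blast
        with i False show ?thesis
          by (intro exI[of _ "simple_refl i a"] exI[of _ "simple_refl i b"])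
             (auto simp: simple_refl_def transpose_def)
      qed
      moreover have "count_list xs k \<le> PosPair n k (?u \<circ> simple_refl i) + 1"
        using IH PosPair_mono[OF i False asc] by linarith
      ultimately show ?thesis
        using False unfolding eq by (simp del: o_apply)
    next
      case True
      let ?v = "?u \<circ> simple_refl k"
      have sub: "pos_pairs n k ?u \<subseteq> pos_pairs n k ?v"
        using asc True by (intro pos_pairs_subset[OF assms(1)]) simp
      \<comment> \<open>The \<open>+ 1\<close> is dropped to make room for the new letter
        \<open>k\<close>. If \<open>k\<close> has occurred before, the set of pairs grows strictly;
        otherwise the count is 0.\<close>
      have "count_list xs k \<le> PosPair n k ?v"
      proof (cases "count_list xs k > 0")
        case pos: True
        then obtain a b where "1 \<le> a" "a \<le> k" "k < b" "b \<le> n" "?u a > ?u b"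
          using IH by blast
        then have "pos_pairs n k ?u \<noteq> pos_pairs n k ?v"
          using asc True by (intro pos_pairs_psubset[OF bij_is_inj[OF bij_word_prod] assms(1)]) auto
        with sub have "PosPair n k ?u < PosPair n k ?v"
          unfolding PosPair_def by (intro psubset_card_mono finite_pos_pairs) blast
        with IH show ?thesis by simp
      qed simp
      moreover have "\<exists>a b. 1 \<le> a \<and> a \<le> k \<and> k < b \<and> b \<le> n \<and> ?v a > ?v b"
        using assms(1) asc True
        by (intro exI[of _ k] exI[of _ "Suc k"]) (auto simp: simple_refl_def)
      ultimately show ?thesis using True unfolding eq by (simp del: o_apply)
    qed
  qed simp
  moreover have "word_prod as = w"
    using assms(2) by (simp add: reduced_decomps_def decomps_def)
  ultimately show ?thesis by fastforce
qed

section \<open>Position pairs against value pairs of the inverse\<close>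

text \<open>For \<open>v = inv w\<close> these are the value pairs of \<open>w\<close> with swapped
  components, because 321 and 3412 are involutions and inversion exchanges positions with
  values.\<close>

definition outer_pairs :: "nat \<Rightarrow> nat \<Rightarrow> (nat \<Rightarrow> nat) \<Rightarrow> (nat \<times> nat) set" where
  "outer_pairs n k v =
     {(i1, i3) | i1 i2 i3. occ321 n v i1 i2 i3 \<and> i1 \<le> k \<and> k < i3} \<union>
     {(i1, i4) | i1 i2 i3 i4. occ3412 n v i1 i2 i3 i4 \<and> i2 \<le> k \<and> k < i3}"

lemma finite_outer_pairs: "finite (outer_pairs n k v)"
  by (rule finite_subset[of _ "{1..n} \<times> {1..n}"])
     (auto simp: outer_pairs_def occ321_def occ3412_def)

lemma card_outer_pairs_le_ValPair:
  assumes "w permutes {1..n}"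
  shows "card (outer_pairs n k (inv w)) \<le> ValPair n k w"
proof -
  let ?v = "inv w"
  have w: "w (?v x) = x" for x
    using assms by (simp add: permutes_inverses)
  have v: "?v x \<in> {1..n} \<longleftrightarrow> x \<in> {1..n}" for x
    using permutes_in_image[OF permutes_inv[OF assms]] .
  have sub: "prod.swap ` outer_pairs n k ?v \<subseteq> val_pairs n k w"
  proof (rule image_subsetI)
    fix x assume x: "x \<in> outer_pairs n k ?v"
    obtain p q where pq: "x = (p, q)" by fastforce
    from x[unfolded pq] consider
        z where "occ321 n ?v p z q" "p \<le> k" "k < q"
      | i2 i3 where "occ3412 n ?v p i2 i3 q" "i2 \<le> k" "k < i3"
      unfolding outer_pairs_def by blast
    then show "prod.swap x \<in> val_pairs n k w"
    proof cases
      case 1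
      then have "occ321 n w (?v q) (?v z) (?v p)"
        using v[of q] v[of p] by (auto simp: occ321_def w)
      with 1 have "(w (?v q), w (?v p)) \<in> val_pairs n k w"
        unfolding val_pairs_def
        by (intro UnI1 CollectI exI[of _ "?v q"] exI[of _ "?v z"] exI[of _ "?v p"]) (simp add: w)
      then show ?thesis by (simp add: w pq)
    next
      case 2
      \<comment> \<open>The four positions are listed by increasing value under
        \<open>?v\<close>.\<close>
      then have "occ3412 n w (?v i3) (?v q) (?v p) (?v i2)"
        using v[of i3] v[of i2] by (auto simp: occ3412_def w)
      with 2 have "(w (?v q), w (?v p)) \<in> val_pairs n k w"
        unfolding val_pairs_def
        by (intro UnI2 CollectI exI[of _ "?v i3"] exI[of _ "?v q"] exI[of _ "?v p"] exI[of _ "?v i2"])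
           (simp add: w)
      then show ?thesis by (simp add: w pq)
    qed
  qed
  have "finite (val_pairs n k w)"
    by (rule finite_subset[of _ "(w ` {1..n}) \<times> (w ` {1..n})"])
       (auto simp: val_pairs_def occ321_def occ3412_def)
  then show ?thesis
    unfolding ValPair_def using sub by (intro card_inj_on_le[of prod.swap]) auto
qed

text \<open>
  A position pair \<open>(p, q)\<close> that is not the outer pair of a 321-occurrence is matched with the
  \<open>(r, s)\<close> of smallest \<open>s - r\<close> such that \<open>r, p, q, s\<close> is a 3412-occurrence. Minimality makes
  \<open>(r, s)\<close> again not the outer pair of a 321-occurrence and makes the matching injective.
\<close>

lemma card_pos_pairs_le_outer_pairs:
  assumes "inj v"
  shows "card (pos_pairs n k v) \<le> card (outer_pairs n k v)"
proof -
  define T where "T p q \<longleftrightarrow> (\<exists>z. occ321 n v p z q)" for p q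
  \<comment> \<open>The two clauses are all that is used of minimality: no \<open>t\<close> closer
    to \<open>p\<close> can replace \<open>r\<close>, and no \<open>t\<close> closer to
    \<open>q\<close> can replace \<open>s\<close>.\<close>
  define M where "M p q r s \<longleftrightarrow> occ3412 n v r p q s \<and>
      (\<forall>t. r < t \<and> t < p \<longrightarrow> \<not> (v s < v t \<and> v t < v p)) \<and>
      (\<forall>t. q < t \<and> t < s \<longrightarrow> \<not> (v q < v t \<and> v t < v r))" for p q r s
  \<comment> \<open>A relation avoids choosing one \<open>(r, s)\<close>. The condition on
    \<open>T r s\<close> keeps the targets of the two branches disjoint.\<close>
  define R where "R = (\<lambda>(p, q) (r, s).
      if T p q then (r, s) = (p, q) else \<not> T r s \<and> p \<le> k \<and> k < q \<and> M p q r s)"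
  have not_T: "v z \<ge> v p \<or> v z \<le> v q" if "\<not> T p q" "1 \<le> p" "q \<le> n" "p < z" "z < q" for p q z
    using that unfolding T_def occ321_def by (meson not_le)
  have ex: "\<exists>rs\<in>outer_pairs n k v. R (p, q) rs" if pq: "(p, q) \<in> pos_pairs n k v" for p q
  proof (cases "T p q")
    case True
    have "p \<le> k" "k < q" using pq by (auto simp: pos_pairs_iff)
    with True show ?thesis
      by (intro bexI[of _ "(p, q)"]) (auto simp: R_def T_def outer_pairs_def)
  next
    case False
    with pq obtain r s where "occ3412 n v r p q s" and k: "p \<le> k" "k < q"
      unfolding pos_pairs_def T_def by blast
    then obtain r s where rs: "occ3412 n v r p q s"
      and min: "\<And>r' s'. occ3412 n v r' p q s' \<Longrightarrow> s - r \<le> s' - r'"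
      using ex_has_least_nat[of "\<lambda>(r, s). occ3412 n v r p q s" "(r, s)" "\<lambda>(r, s). s - r"]
      by auto
    have M: "M p q r s"
      unfolding M_def
    proof (intro conjI allI impI notI)
      fix t assume t: "r < t \<and> t < p" "v s < v t \<and> v t < v p"
      with rs have "occ3412 n v t p q s" by (auto simp: occ3412_def)
      from min[OF this] t rs show False by (auto simp: occ3412_def)
    next
      fix t assume t: "q < t \<and> t < s" "v q < v t \<and> v t < v r"
      with rs have "occ3412 n v r p q t" by (auto simp: occ3412_def)
      from min[OF this] t rs show False by (auto simp: occ3412_def)
    qed (rule rs)
    \<comment> \<open>A middle \<open>z\<close> left of \<open>p\<close> or right of
      \<open>q\<close> contradicts a clause of \<open>M\<close>; one between them would give
      \<open>T p q\<close>. At \<open>p\<close> or \<open>q\<close> the value is out of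
      range.\<close>
    have "\<not> T r s"
    proof
      assume "T r s"
      then obtain z where z: "r < z" "z < s" "v s < v z" "v z < v r"
        by (auto simp: T_def occ321_def)
      have o: "r < p" "p < q" "q < s" "v q < v s" "v s < v r" "v r < v p" "1 \<le> p" "q \<le> n"
        using rs by (auto simp: occ3412_def)
      consider "z < p" | "z = p" | "p < z" "z < q" | "z = q" | "q < z" by linarith
      then show False
      proof cases
        case 1
        with M z o show False unfolding M_def by (meson less_trans)
      next
        case 3
        with not_T[OF False, of z] z o show False by auto
      next
        case 5
        with M z o show False unfolding M_def by (meson less_trans)
      qed (use z o in auto)
    qed
    with False M k have "R (p, q) (r, s)" by (auto simp: R_def)
    moreover have "(r, s) \<in> outer_pairs n k v"
      using rs k unfolding outer_pairs_def by blast
    ultimately show ?thesis by blast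
  qed
  \<comment> \<open>The clause of \<open>M\<close> about \<open>s\<close> forces
    \<open>v q2 < v q1\<close>. As \<open>p2 \<le> k < q1\<close>, position \<open>q1\<close> is
    then the middle of a 321 with ends \<open>p2\<close>, \<open>q2\<close>.\<close>
  have eq_q: False if "q1 < q2" "\<not> T p1 q1" "\<not> T p2 q2" "p1 \<le> k" "k < q1" "p2 \<le> k" "k < q2"
    "M p1 q1 r s" "M p2 q2 r s" for p1 q1 p2 q2 r s
  proof -
    have o: "occ3412 n v r p1 q1 s" "occ3412 n v r p2 q2 s" using that by (auto simp: M_def)
    have ne: "v q1 \<noteq> v q2" using that(1) assms by (auto dest: injD)
    have "\<not> (v q1 < v q2 \<and> v q2 < v r)"
      using that(1,8) o by (auto simp: M_def occ3412_def)
    with ne o have "v q2 < v q1" by (auto simp: occ3412_def)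
    moreover have "v q1 < v p2" using o by (auto simp: occ3412_def)
    ultimately show False
      using not_T[OF that(3), of q1] that o by (auto simp: occ3412_def)
  qed
  \<comment> \<open>Dually, the clause about \<open>r\<close> makes \<open>p2\<close> the middle of
    a 321 with ends \<open>p1\<close>, \<open>q\<close>.\<close>
  have eq_p: False if "p1 < p2" "\<not> T p1 q" "p2 \<le> k" "k < q"
    "M p1 q r s" "M p2 q r s" for p1 p2 q r s
  proof -
    have o: "occ3412 n v r p1 q s" "occ3412 n v r p2 q s" using that by (auto simp: M_def)
    have ne: "v p1 \<noteq> v p2" using that(1) assms by (auto dest: injD)
    have "\<not> (v s < v p1 \<and> v p1 < v p2)"
      using that(1,6) o by (auto simp: M_def occ3412_def)
    with ne o have "v p2 < v p1" by (auto simp: occ3412_def)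
    moreover have "v q < v p2" using o by (auto simp: occ3412_def)
    ultimately show False
      using not_T[OF that(2), of p2] that o by (auto simp: occ3412_def)
  qed
  have inj: "x = y" if "R x z" "R y z" for x y z
  proof -
    obtain p1 q1 p2 q2 r s where xyz: "x = (p1, q1)" "y = (p2, q2)" "z = (r, s)"
      by (metis surj_pair)
    show ?thesis
    proof (cases "T r s")
      case True
      with that xyz show ?thesis by (auto simp: R_def split: if_splits)
    next
      case False
      with that xyz have h: "\<not> T p1 q1" "\<not> T p2 q2" "p1 \<le> k" "k < q1" "p2 \<le> k" "k < q2"
        "M p1 q1 r s" "M p2 q2 r s"
        by (auto simp: R_def split: if_splits)
      have q: "q1 = q2"
        using eq_q[of q1 q2 p1 p2 r s] eq_q[of q2 q1 p2 p1 r s] h by (metis linorder_cases)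
      have "p1 = p2"
        using eq_p[of p1 p2 q1 r s] eq_p[of p2 p1 q1 r s] h unfolding q by (metis linorder_cases)
      with q xyz show ?thesis by simp
    qed
  qed
  show ?thesis
  proof (rule card_le_if_inj_on_rel[where r = R])
    show "\<exists>rs. rs \<in> outer_pairs n k v \<and> R x rs" if "x \<in> pos_pairs n k v" for x
      using that ex by (cases x) blast
    show "x = y" if "R x z" "R y z" for x y z
      using inj that .
  qed (rule finite_outer_pairs)
qed

theorem theorem4p1:
  fixes n k :: nat and w :: "nat \<Rightarrow> nat"
  assumes "w permutes {1..n}"
    and "k \<in> {1..n - 1}"
  shows "max_occ n k w \<le> min (ValPair n k w) (PosPair n k w) + 1"
proof -
  have "count_list as k \<le> min (ValPair n k w) (PosPair n k w) + 1"
    if as: "as \<in> reduced_decomps n w" for as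
  proof -
    have "count_list as k = count_list (rev as) k" by simp
    also have "\<dots> \<le> PosPair n k (inv w) + 1"
      using assms(2) rev_reduced_decomps[OF assms(1) as] by (rule count_list_le_PosPair)
    also have "PosPair n k (inv w) \<le> card (outer_pairs n k (inv w))"
      unfolding PosPair_def
      using permutes_inj[OF permutes_inv[OF assms(1)]] by (rule card_pos_pairs_le_outer_pairs)
    also have "\<dots> \<le> ValPair n k w"
      using assms(1) by (rule card_outer_pairs_le_ValPair)
    finally show ?thesis
      using count_list_le_PosPair[OF assms(2) as] by simp
  qed
  then show ?thesis
    unfolding max_occ_def
    using reduced_decomps_nonempty[OF assms(1)] finite_reduced_decomps[of n w] by (subst Max_le_iff) auto
qed

end
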